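(* Let $\lambda>0$, $\sigma>0$, let $X$ be a real $n\times p$ matrix, $Y\in\mathbb{R}^n$, and let $$\hat\beta(\sigma):=\arg\min_{\beta\in\mathbb{R}^p}\Big\{\|Y-X\beta\|_n^2+2\lambda\sigma\|\beta\|_1\Big\}.$$ Define $$\tilde\sigma^2(\sigma):=\|Y-X\hat\beta(\sigma)\|_n^2+\lambda\sigma\|\hat\beta(\sigma)\|_1 .$$ Then $$\tilde\sigma^2(\sigma)=Y^T(Y-X\hat\beta(\sigma))/n .$$
   Context: For $v\in\mathbb{R}^n$, $\|v\|_n:=\sqrt{v^Tv/n}$; $\|\cdot\|_1$ is the $\ell_1$-norm. $\hat\beta(\sigma)$ denotes any minimizer. *)

theory Defs
  imports "HOL-Analysis.Analysis"
begin

definition norm_n :: "real ^ 'n \<Rightarrow> real" where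
  "norm_n v = sqrt ((v \<bullet> v) / real CARD('n))"

definition norm_l1 :: "real ^ 'p \<Rightarrow> real" where
  "norm_l1 b = (\<Sum>j\<in>UNIV. \<bar>b $ j\<bar>)"

definition lasso_objective ::
    "real \<Rightarrow> real \<Rightarrow> real ^ 'p ^ 'n \<Rightarrow> real ^ 'n \<Rightarrow> real ^ 'p \<Rightarrow> real" where
  "lasso_objective lam sig X Y b = (norm_n (Y - X *v b))\<^sup>2 + 2 * lam * sig * norm_l1 b"

(* The minimizer need not be unique, so being a Lasso estimator is a predicate. *)
definition is_lasso_estimator ::
    "real \<Rightarrow> real \<Rightarrow> real ^ 'p ^ 'n \<Rightarrow> real ^ 'n \<Rightarrow> real ^ 'p \<Rightarrow> bool" where
  "is_lasso_estimator lam sig X Y b \<longleftrightarrow> is_arg_min (lasso_objective lam sig X Y) (\<lambda>_. True) b"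

(* The quantity written as the square of sigma-tilde, evaluated at a given minimizer b;
   its penalty term has the factor lam * sig, half of the one in the objective. *)
definition sigma_tilde_sq ::
    "real \<Rightarrow> real \<Rightarrow> real ^ 'p ^ 'n \<Rightarrow> real ^ 'n \<Rightarrow> real ^ 'p \<Rightarrow> real" where
  "sigma_tilde_sq lam sig X Y b = (norm_n (Y - X *v b))\<^sup>2 + lam * sig * norm_l1 b"

end

theory Submission
  imports Defs
begin

text \<open>The objective restricted to the ray \<open>t \<mapsto> t \<beta>\<close>, \<open>t \<ge> 0\<close>, is a quadratic polynomial, since the
  \<open>\<ell>\<^sub>1\<close>-norm is positively homogeneous. It is minimal at the interior point \<open>t = 1\<close>, so its linear
  coefficient there vanishes: \<open>(Y - X \<beta>) \<bullet> X \<beta> / n = \<lambda> \<sigma> \<parallel>\<beta>\<parallel>\<^sub>1\<close>.\<close>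

lemma norm_n_power2: "(norm_n (v :: real ^ 'n))\<^sup>2 = (v \<bullet> v) / real CARD('n)"
  by (simp add: norm_n_def)

lemma norm_l1_scaleR: "norm_l1 (c *\<^sub>R b) = \<bar>c\<bar> * norm_l1 b"
  by (simp add: norm_l1_def abs_mult sum_distrib_left)

lemma lasso_objective_ray:
  fixes X :: "real ^ 'p ^ 'n"
  assumes "s \<ge> -1"
  shows "lasso_objective lam sig X Y ((1 + s) *\<^sub>R b) = lasso_objective lam sig X Y b
    + 2 * (lam * sig * norm_l1 b - (Y - X *v b) \<bullet> (X *v b) / real CARD('n)) * s
    + (X *v b) \<bullet> (X *v b) / real CARD('n) * s\<^sup>2"
proof -
  have "lasso_objective lam sig X Y ((1 + s) *\<^sub>R b)
      = (Y - X *v ((1 + s) *\<^sub>R b)) \<bullet> (Y - X *v ((1 + s) *\<^sub>R b)) / real CARD('n)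
        + 2 * lam * sig * ((1 + s) * norm_l1 b)"
    unfolding lasso_objective_def norm_n_power2 norm_l1_scaleR using assms by simp
  moreover have "Y - X *v ((1 + s) *\<^sub>R b) = (Y - X *v b) - s *\<^sub>R (X *v b)"
    by (simp add: matrix_vector_mult_scaleR scaleR_add_left matrix_vector_right_distrib)
  moreover have "(r - s *\<^sub>R w) \<bullet> (r - s *\<^sub>R w) = r \<bullet> r - 2 * s * (r \<bullet> w) + s\<^sup>2 * (w \<bullet> w)"
    for r w :: "real ^ 'n"
    by (simp add: inner_diff_left inner_diff_right inner_commute power2_eq_square algebra_simps)
  ultimately show ?thesis
    by (simp only: lasso_objective_def norm_n_power2) (simp add: field_simps)
qed

lemma local_min_quadratic_linear_coeff:
  fixes a c d :: real
  assumes "d > 0" and nonneg: "\<And>s. \<bar>s\<bar> < d \<Longrightarrow> 0 \<le> c * s + a * s\<^sup>2"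
  shows "c = 0"
proof (rule DERIV_local_min)
  show "((\<lambda>s. c * s + a * s\<^sup>2) has_real_derivative c) (at 0)"
    by (auto intro!: derivative_eq_intros)
qed (use assms in auto)

lemma lasso_estimator_stationary:
  fixes X :: "real ^ 'p ^ 'n"
  assumes "is_lasso_estimator lam sig X Y b"
  shows "lam * sig * norm_l1 b = (Y - X *v b) \<bullet> (X *v b) / real CARD('n)"
proof -
  let ?f = "lasso_objective lam sig X Y"
  have min: "?f b \<le> ?f b'" for b'
    using assms by (auto simp: is_lasso_estimator_def is_arg_min_def not_less)
  have "2 * (lam * sig * norm_l1 b - (Y - X *v b) \<bullet> (X *v b) / real CARD('n)) = 0"
  proof (rule local_min_quadratic_linear_coeff[where d = 1])
    fix s :: real
    assume "\<bar>s\<bar> < 1"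
    then show "0 \<le> 2 * (lam * sig * norm_l1 b - (Y - X *v b) \<bullet> (X *v b) / real CARD('n)) * s
        + (X *v b) \<bullet> (X *v b) / real CARD('n) * s\<^sup>2"
      using min[of "(1 + s) *\<^sub>R b"] by (simp add: lasso_objective_ray)
  qed simp
  then show ?thesis by simp
qed

theorem lemma1p5p1:
  fixes lam sig :: real
    and X :: "real ^ 'p ^ 'n" and Y :: "real ^ 'n"
    and beta_hat :: "real ^ 'p"
  assumes "lam > 0" and "sig > 0"
    and "is_lasso_estimator lam sig X Y beta_hat"
  shows "sigma_tilde_sq lam sig X Y beta_hat
           = (Y \<bullet> (Y - X *v beta_hat)) / real CARD('n)"
proof -
  let ?r = "Y - X *v beta_hat"
  have "sigma_tilde_sq lam sig X Y beta_hat = (?r \<bullet> ?r + ?r \<bullet> (X *v beta_hat)) / real CARD('n)"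
    by (simp add: sigma_tilde_sq_def norm_n_power2 lasso_estimator_stationary[OF assms(3)]
        add_divide_distrib)
  also have "?r \<bullet> ?r + ?r \<bullet> (X *v beta_hat) = Y \<bullet> ?r"
    by (simp add: inner_diff_left inner_diff_right inner_commute)
  finally show ?thesis .
qed

end
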